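(* Let $M$ be an $n$-dimensional Frobenius manifold and $p\in M\setminus\mathcal A_\Lambda$. Let $\mathcal X_p$ be the $\mathbb C$-vector space of solutions $\xi$ on $\widetilde{\mathbb C^*}$ of $\frac{\partial}{\partial z}\xi=\big(\mathcal U(p)^T-\frac1z\mu\big)\xi$. Then the linear map $$\nu_p:\mathcal X_p\to\mathcal O(\widetilde{\mathbb C^*}),\qquad \xi\mapsto\Phi_\xi,\qquad \Phi_\xi(z)=z^{-\frac d2}\langle\xi(z,p),e(p)\rangle,$$ where $d$ is the charge of $M$, is injective.
   Context: A Frobenius manifold is a complex manifold $M$ of dimension $n$ with: a nondegenerate symmetric $\mathcal O(M)$-bilinear metric $\eta$ on $TM$ with flat Levi-Civita connection $\nabla$; a commutative associative product $\circ$ on $TM$, given by a $(1,2)$-tensor $c$, such that $c^\flat(X,Y,Z)=\eta(X,Y\circ Z)$ and $\nabla c^\flat$ are totally symmetric; a unit vector field $e$ with $\nabla e=0$; an Euler vector field $E$ with $\mathfrak L_Ec=c$ and $\mathfrak L_E\eta=(2-d)\eta$, where $d\in\mathbb C$ is the charge. Standing assumptions: the flat endomorphism $X\mapsto\nabla_XE$ is diagonalizable, flat coordinates $t^1,\dots,t^n$ are chosen with $\partial/\partial t^1=e$ (and so that $\nabla E$ is diagonal), and $M$ is generically semisimple (the set of points $p$ where $(T_pM,\circ_p)$ has no nilpotents is nonempty). Put $\boldsymbol\mu(Y)=\frac{2-d}{2}Y-\nabla_YE$ and $\boldsymbol{\mathcal U}(Y)=E\circ Y$; $\mu$ and $\mathcal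 U$ are their matrices with respect to $\partial/\partial t^\alpha$. Here $\xi$ is the column of components, with respect to $dt^1,\dots,dt^n$, of a covector at $p$ depending on $z$, and $\widetilde{\mathbb C^*}$ is the universal cover of $\mathbb C^*$. Let $\widehat M=\mathbb C^*\times M$, $\pi:\widehat M\to M$ the projection. On $\pi^*TM$ let $\widehat\nabla_XY=\nabla_XY+zX\circ Y$, $\widehat\nabla_{\partial/\partial z}Y=\nabla_{\partial/\partial z}Y+\boldsymbol{\mathcal U}(Y)-\frac1z\boldsymbol\mu(Y)$, where $\nabla_{\partial/\partial z}Y=0$ for $Y$ pulled back from $M$. Put $e_k=\widehat\nabla^k_{\partial/\partial z}e$. The cyclic stratum $\widehat M^{\rm cyc}$ is the maximal open subset of $\widehat M$ on which $(e_0,\dots,e_{n-1})$ is a basis of each fiber of $\pi^*TM$. The $\mathcal A_\Lambda$-stratum is $\mathcal A_\Lambda=\{p\in M:\ \mathbb C^*\times\{p\}\subseteq\widehat M\setminus\widehat M^{\rm cyc}\}$. *)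

theory Defs
  imports "HOL-Analysis.Analysis"
begin

unbundle no fps_syntax

section \<open>Complex manifolds\<close>

text \<open>
  Holomorphic functions of several variables: Frechet differentiable with \<open>\<complex>\<close>-linear derivative
  at every point of the (open) domain.
\<close>

definition holomorphic_several :: "(complex^'n::finite) set \<Rightarrow> (complex^'n \<Rightarrow> complex) \<Rightarrow> bool" where
  "holomorphic_several S f \<longleftrightarrow>
     (\<forall>x\<in>S. \<exists>L. (f has_derivative L) (at x) \<and> (\<forall>a v. L (a *s v) = a * L v))"

text \<open>
  A chart is a pair of a domain and a coordinate map; the values of the coordinate map outside
  the domain are irrelevant.
\<close>

type_synonym ('m, 'n) chart = "'m set \<times> ('m \<Rightarrow> complex^'n)"

definition chart_inv :: "('m, 'n::finite) chart \<Rightarrow> complex^'n \<Rightarrow> 'm" where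
  "chart_inv x = inv_into (fst x) (snd x)"

definition is_chart :: "'m topology \<Rightarrow> ('m, 'n::finite) chart \<Rightarrow> bool" where
  "is_chart T x \<longleftrightarrow>
     openin T (fst x) \<and> open (snd x ` fst x) \<and>
     homeomorphic_map (subtopology T (fst x)) (top_of_set (snd x ` fst x)) (snd x)"

definition holomorphic_transition :: "('m, 'n::finite) chart \<Rightarrow> ('m, 'n) chart \<Rightarrow> bool" where
  "holomorphic_transition x y \<longleftrightarrow>
     (\<forall>i. holomorphic_several (snd x ` (fst x \<inter> fst y)) (\<lambda>u. snd y (chart_inv x u) $ i))"

definition compatible_charts :: "('m, 'n::finite) chart \<Rightarrow> ('m, 'n) chart \<Rightarrow> bool" where
  "compatible_charts x y \<longleftrightarrow> holomorphic_transition x y \<and> holomorphic_transition y x"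

text \<open>The holomorphic structure is given by its maximal atlas \<open>A\<close>; the dimension is \<open>CARD('n)\<close>.\<close>

locale complex_manifold =
  fixes T :: "'m topology" and A :: "('m, 'n::finite) chart set"
  assumes Hausdorff: "Hausdorff_space T"
    and second_countable: "second_countable T"
    and charts: "x \<in> A \<Longrightarrow> is_chart T x"
    and charts_cover: "\<Union> (fst ` A) = topspace T"
    and compatible: "x \<in> A \<Longrightarrow> y \<in> A \<Longrightarrow> compatible_charts x y"
    and maximal: "is_chart T y \<Longrightarrow> (\<And>x. x \<in> A \<Longrightarrow> compatible_charts x y) \<Longrightarrow> y \<in> A"

section \<open>Tensor fields\<close>

text \<open>
  A tensor field on the manifold is the family of its components in all charts of the atlas,
  subject to the tensorial transformation law. \<open>X x q\<close> denotes the components at the point \<open>q\<close>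
  with respect to the coordinate frame \<open>\<partial>/\<partial>x\<close> of the chart \<open>x\<close>.
\<close>

text \<open>\<open>\<partial>f/\<partial>x\<^sup>j\<close> at \<open>q\<close>.\<close>

definition pderiv_chart :: "('m, 'n::finite) chart \<Rightarrow> 'n \<Rightarrow> ('m \<Rightarrow> complex) \<Rightarrow> 'm \<Rightarrow> complex" where
  "pderiv_chart x j f q = deriv (\<lambda>h. f (chart_inv x (snd x q + axis j h))) 0"

definition holomorphic_in_chart :: "('m, 'n::finite) chart \<Rightarrow> ('m \<Rightarrow> complex) \<Rightarrow> bool" where
  "holomorphic_in_chart x f \<longleftrightarrow> holomorphic_several (snd x ` fst x) (\<lambda>u. f (chart_inv x u))"

text \<open>The matrix \<open>(\<partial>y\<^sup>i/\<partial>x\<^sup>j)\<close>.\<close>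

definition jacobian_chart :: "('m, 'n::finite) chart \<Rightarrow> ('m, 'n) chart \<Rightarrow> 'm \<Rightarrow> complex^'n^'n" where
  "jacobian_chart x y q = (\<chi> i j. pderiv_chart x j (\<lambda>r. snd y r $ i) q)"

definition vector_field ::
    "('m, 'n::finite) chart set \<Rightarrow> (('m, 'n) chart \<Rightarrow> 'm \<Rightarrow> complex^'n) \<Rightarrow> bool" where
  "vector_field A X \<longleftrightarrow>
     (\<forall>x\<in>A. \<forall>i. holomorphic_in_chart x (\<lambda>q. X x q $ i)) \<and>
     (\<forall>x\<in>A. \<forall>y\<in>A. \<forall>q \<in> fst x \<inter> fst y. X y q = jacobian_chart x y q *v X x q)"

definition covariant_2_tensor ::
    "('m, 'n::finite) chart set \<Rightarrow> (('m, 'n) chart \<Rightarrow> 'm \<Rightarrow> complex^'n^'n) \<Rightarrow> bool" where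
  "covariant_2_tensor A \<eta> \<longleftrightarrow>
     (\<forall>x\<in>A. \<forall>i j. holomorphic_in_chart x (\<lambda>q. \<eta> x q $ i $ j)) \<and>
     (\<forall>x\<in>A. \<forall>y\<in>A. \<forall>q \<in> fst x \<inter> fst y.
        \<eta> x q = transpose (jacobian_chart x y q) ** \<eta> y q ** jacobian_chart x y q)"

text \<open>
  A (1,2)-tensor has components \<open>c $ k $ i $ j\<close>, that is
  \<open>\<partial>\<^sub>i \<circ> \<partial>\<^sub>j = (\<Sum>k. c $ k $ i $ j *s \<partial>\<^sub>k)\<close>.
\<close>

definition mult :: "complex^'n^'n^'n \<Rightarrow> complex^'n \<Rightarrow> complex^'n \<Rightarrow> complex^'n::finite" where
  "mult c u v = (\<chi> k. \<Sum>i\<in>UNIV. \<Sum>j\<in>UNIV. c $ k $ i $ j * u $ i * v $ j)"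

definition tensor_1_2 ::
    "('m, 'n::finite) chart set \<Rightarrow> (('m, 'n) chart \<Rightarrow> 'm \<Rightarrow> complex^'n^'n^'n) \<Rightarrow> bool" where
  "tensor_1_2 A c \<longleftrightarrow>
     (\<forall>x\<in>A. \<forall>k i j. holomorphic_in_chart x (\<lambda>q. c x q $ k $ i $ j)) \<and>
     (\<forall>x\<in>A. \<forall>y\<in>A. \<forall>q \<in> fst x \<inter> fst y. \<forall>u v.
        mult (c y q) (jacobian_chart x y q *v u) (jacobian_chart x y q *v v)
          = jacobian_chart x y q *v mult (c x q) u v)"

section \<open>Levi-Civita connection\<close>

text \<open>\<open>\<Gamma>\<^sup>k\<^sub>i\<^sub>j\<close>, where \<open>\<nabla>\<^bsub>\<partial>\<^sub>i\<^esub> \<partial>\<^sub>j = \<Gamma>\<^sup>k\<^sub>i\<^sub>j \<partial>\<^sub>k\<close>.\<close>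

definition christoffel ::
    "(('m, 'n::finite) chart \<Rightarrow> 'm \<Rightarrow> complex^'n^'n) \<Rightarrow> ('m, 'n) chart \<Rightarrow> 'n \<Rightarrow> 'n \<Rightarrow> 'n \<Rightarrow> 'm \<Rightarrow> complex"
  where
  "christoffel \<eta> x k i j q =
     (1/2) * (\<Sum>l\<in>UNIV. matrix_inv (\<eta> x q) $ k $ l *
        (pderiv_chart x i (\<lambda>r. \<eta> x r $ j $ l) q
         + pderiv_chart x j (\<lambda>r. \<eta> x r $ i $ l) q
         - pderiv_chart x l (\<lambda>r. \<eta> x r $ i $ j) q))"

text \<open>\<open>R(\<partial>\<^sub>i, \<partial>\<^sub>j) \<partial>\<^sub>k = R\<^sup>l\<^sub>k\<^sub>i\<^sub>j \<partial>\<^sub>l\<close>.\<close>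

definition curvature ::
    "(('m, 'n::finite) chart \<Rightarrow> 'm \<Rightarrow> complex^'n^'n) \<Rightarrow> ('m, 'n) chart
       \<Rightarrow> 'n \<Rightarrow> 'n \<Rightarrow> 'n \<Rightarrow> 'n \<Rightarrow> 'm \<Rightarrow> complex"
  where
  "curvature \<eta> x l k i j q =
     pderiv_chart x i (christoffel \<eta> x l j k) q - pderiv_chart x j (christoffel \<eta> x l i k) q
     + (\<Sum>m\<in>UNIV. christoffel \<eta> x l i m q * christoffel \<eta> x m j k q)
     - (\<Sum>m\<in>UNIV. christoffel \<eta> x l j m q * christoffel \<eta> x m i k q)"

text \<open>
  Matrix, with respect to the coordinate frame, of the endomorphism \<open>Y \<mapsto> \<nabla>\<^sub>Y X\<close>:
  row \<open>k\<close>, column \<open>j\<close> contains the \<open>k\<close>-th component of the covariant derivative of \<open>X\<close>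
  along \<open>\<partial>\<^sub>j\<close>.
\<close>

definition nabla_matrix ::
    "(('m, 'n::finite) chart \<Rightarrow> 'm \<Rightarrow> complex^'n^'n) \<Rightarrow> (('m, 'n) chart \<Rightarrow> 'm \<Rightarrow> complex^'n)
       \<Rightarrow> ('m, 'n) chart \<Rightarrow> 'm \<Rightarrow> complex^'n^'n"
  where
  "nabla_matrix \<eta> X x q =
     (\<chi> k j. pderiv_chart x j (\<lambda>r. X x r $ k) q
              + (\<Sum>i\<in>UNIV. christoffel \<eta> x k j i q * X x q $ i))"

section \<open>Frobenius manifolds\<close>

text \<open>\<open>\<eta>(\<partial>\<^sub>i, \<partial>\<^sub>j \<circ> \<partial>\<^sub>k)\<close>\<close>

definition c_flat ::
    "(('m, 'n::finite) chart \<Rightarrow> 'm \<Rightarrow> complex^'n^'n) \<Rightarrow> (('m, 'n) chart \<Rightarrow> 'm \<Rightarrow> complex^'n^'n^'n)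
       \<Rightarrow> ('m, 'n) chart \<Rightarrow> 'n \<Rightarrow> 'n \<Rightarrow> 'n \<Rightarrow> 'm \<Rightarrow> complex"
  where
  "c_flat \<eta> c x i j k q = (\<Sum>l\<in>UNIV. \<eta> x q $ i $ l * c x q $ l $ j $ k)"

text \<open>\<open>(\<nabla>\<^bsub>\<partial>\<^sub>l\<^esub> c\<^sup>\<flat>)(\<partial>\<^sub>i, \<partial>\<^sub>j, \<partial>\<^sub>k)\<close>\<close>

definition nabla_c_flat ::
    "(('m, 'n::finite) chart \<Rightarrow> 'm \<Rightarrow> complex^'n^'n) \<Rightarrow> (('m, 'n) chart \<Rightarrow> 'm \<Rightarrow> complex^'n^'n^'n)
       \<Rightarrow> ('m, 'n) chart \<Rightarrow> 'n \<Rightarrow> 'n \<Rightarrow> 'n \<Rightarrow> 'n \<Rightarrow> 'm \<Rightarrow> complex"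
  where
  "nabla_c_flat \<eta> c x l i j k q =
     pderiv_chart x l (c_flat \<eta> c x i j k) q
     - (\<Sum>m\<in>UNIV. christoffel \<eta> x m l i q * c_flat \<eta> c x m j k q)
     - (\<Sum>m\<in>UNIV. christoffel \<eta> x m l j q * c_flat \<eta> c x i m k q)
     - (\<Sum>m\<in>UNIV. christoffel \<eta> x m l k q * c_flat \<eta> c x i j m q)"

text \<open>Total symmetry is stated for the adjacent transpositions, which generate all permutations.\<close>

definition symmetric3 :: "('n \<Rightarrow> 'n \<Rightarrow> 'n \<Rightarrow> complex) \<Rightarrow> bool" where
  "symmetric3 S \<longleftrightarrow> (\<forall>i j k. S i j k = S j i k \<and> S i j k = S i k j)"

definition symmetric4 :: "('n \<Rightarrow> 'n \<Rightarrow> 'n \<Rightarrow> 'n \<Rightarrow> complex) \<Rightarrow> bool" where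
  "symmetric4 S \<longleftrightarrow>
     (\<forall>l i j k. S l i j k = S i l j k \<and> S l i j k = S l j i k \<and> S l i j k = S l i k j)"

definition lie_metric ::
    "(('m, 'n::finite) chart \<Rightarrow> 'm \<Rightarrow> complex^'n) \<Rightarrow> (('m, 'n) chart \<Rightarrow> 'm \<Rightarrow> complex^'n^'n)
       \<Rightarrow> ('m, 'n) chart \<Rightarrow> 'm \<Rightarrow> complex^'n^'n"
  where
  "lie_metric E \<eta> x q =
     (\<chi> i j. \<Sum>m\<in>UNIV.
        E x q $ m * pderiv_chart x m (\<lambda>r. \<eta> x r $ i $ j) q
        + \<eta> x q $ m $ j * pderiv_chart x i (\<lambda>r. E x r $ m) q
        + \<eta> x q $ i $ m * pderiv_chart x j (\<lambda>r. E x r $ m) q)"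

definition lie_product ::
    "(('m, 'n::finite) chart \<Rightarrow> 'm \<Rightarrow> complex^'n) \<Rightarrow> (('m, 'n) chart \<Rightarrow> 'm \<Rightarrow> complex^'n^'n^'n)
       \<Rightarrow> ('m, 'n) chart \<Rightarrow> 'm \<Rightarrow> complex^'n^'n^'n"
  where
  "lie_product E c x q =
     (\<chi> k i j. \<Sum>m\<in>UNIV.
        E x q $ m * pderiv_chart x m (\<lambda>r. c x r $ k $ i $ j) q
        - c x q $ m $ i $ j * pderiv_chart x m (\<lambda>r. E x r $ k) q
        + c x q $ k $ m $ j * pderiv_chart x i (\<lambda>r. E x r $ m) q
        + c x q $ k $ i $ m * pderiv_chart x j (\<lambda>r. E x r $ m) q)"

locale frobenius_manifold = complex_manifold T A
  for T :: "'m topology" and A :: "('m, 'n::finite) chart set" +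
  fixes \<eta> :: "('m, 'n) chart \<Rightarrow> 'm \<Rightarrow> complex^'n^'n"
    and c :: "('m, 'n) chart \<Rightarrow> 'm \<Rightarrow> complex^'n^'n^'n"
    and e :: "('m, 'n) chart \<Rightarrow> 'm \<Rightarrow> complex^'n"
    and E :: "('m, 'n) chart \<Rightarrow> 'm \<Rightarrow> complex^'n"
    and d :: complex
  assumes metric_tensor: "covariant_2_tensor A \<eta>"
    and metric_sym: "\<And>x q. x \<in> A \<Longrightarrow> q \<in> fst x \<Longrightarrow> transpose (\<eta> x q) = \<eta> x q"
    and metric_nondegenerate: "\<And>x q. x \<in> A \<Longrightarrow> q \<in> fst x \<Longrightarrow> invertible (\<eta> x q)"
    and metric_flat: "\<And>x q l k i j. x \<in> A \<Longrightarrow> q \<in> fst x \<Longrightarrow> curvature \<eta> x l k i j q = 0"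
    and product_tensor: "tensor_1_2 A c"
    and product_commute: "\<And>x q u v. x \<in> A \<Longrightarrow> q \<in> fst x \<Longrightarrow> mult (c x q) u v = mult (c x q) v u"
    and product_assoc: "\<And>x q u v w. x \<in> A \<Longrightarrow> q \<in> fst x \<Longrightarrow>
          mult (c x q) (mult (c x q) u v) w = mult (c x q) u (mult (c x q) v w)"
    and c_flat_sym: "\<And>x q. x \<in> A \<Longrightarrow> q \<in> fst x \<Longrightarrow> symmetric3 (\<lambda>i j k. c_flat \<eta> c x i j k q)"
    and nabla_c_flat_sym: "\<And>x q. x \<in> A \<Longrightarrow> q \<in> fst x \<Longrightarrow>
          symmetric4 (\<lambda>l i j k. nabla_c_flat \<eta> c x l i j k q)"
    and unit_field: "vector_field A e"
    and unit: "\<And>x q v. x \<in> A \<Longrightarrow> q \<in> fst x \<Longrightarrow> mult (c x q) (e x q) v = v"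
    and unit_flat: "\<And>x q. x \<in> A \<Longrightarrow> q \<in> fst x \<Longrightarrow> nabla_matrix \<eta> e x q = 0"
    and Euler_field: "vector_field A E"
    and Euler_product: "\<And>x q. x \<in> A \<Longrightarrow> q \<in> fst x \<Longrightarrow> lie_product E c x q = c x q"
    and Euler_metric: "\<And>x q. x \<in> A \<Longrightarrow> q \<in> fst x \<Longrightarrow>
          lie_metric E \<eta> x q = (\<chi> i j. (2 - d) * \<eta> x q $ i $ j)"

definition diagonal_mat :: "complex^'n^'n::finite \<Rightarrow> bool" where
  "diagonal_mat B \<longleftrightarrow> (\<forall>i j. i \<noteq> j \<longrightarrow> B $ i $ j = 0)"

definition diagonalizable_mat :: "complex^'n^'n::finite \<Rightarrow> bool" where
  "diagonalizable_mat B \<longleftrightarrow> (\<exists>P :: complex^'n^'n. invertible P \<and> diagonal_mat (matrix_inv P ** B ** P))"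

definition nabla_Euler_diagonalizable ::
    "('m, 'n::finite) chart set \<Rightarrow> (('m, 'n) chart \<Rightarrow> 'm \<Rightarrow> complex^'n^'n)
       \<Rightarrow> (('m, 'n) chart \<Rightarrow> 'm \<Rightarrow> complex^'n) \<Rightarrow> bool"
  where
  "nabla_Euler_diagonalizable A \<eta> E \<longleftrightarrow>
     (\<forall>x\<in>A. \<forall>q \<in> fst x. diagonalizable_mat (nabla_matrix \<eta> E x q))"

text \<open>\<open>(mult c v ^^ m) v\<close> is the power of \<open>v\<close> with exponent \<open>m + 1\<close>.\<close>

definition no_nilpotents :: "complex^'n^'n^'n::finite \<Rightarrow> bool" where
  "no_nilpotents c \<longleftrightarrow> (\<forall>v. (\<exists>m. (mult c v ^^ m) v = 0) \<longrightarrow> v = 0)"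

definition semisimple_at ::
    "('m, 'n::finite) chart set \<Rightarrow> (('m, 'n) chart \<Rightarrow> 'm \<Rightarrow> complex^'n^'n^'n) \<Rightarrow> 'm \<Rightarrow> bool"
  where
  "semisimple_at A c q \<longleftrightarrow> (\<forall>x\<in>A. q \<in> fst x \<longrightarrow> no_nilpotents (c x q))"

definition generically_semisimple ::
    "'m topology \<Rightarrow> ('m, 'n::finite) chart set \<Rightarrow> (('m, 'n) chart \<Rightarrow> 'm \<Rightarrow> complex^'n^'n^'n) \<Rightarrow> bool"
  where
  "generically_semisimple T A c \<longleftrightarrow> {q \<in> topspace T. semisimple_at A c q} \<noteq> {}"

text \<open>
  Flat coordinates \<open>t\<close> (those whose coordinate fields are parallel) with \<open>\<partial>/\<partial>t\<^sup>1 = e\<close> and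
  diagonal \<open>\<nabla>E\<close>. The index type is unordered, so the index called \<open>1\<close> in the literature is an
  arbitrary distinguished element \<open>o1\<close>.
\<close>

definition adapted_flat_coordinates ::
    "('m, 'n::finite) chart set \<Rightarrow> (('m, 'n) chart \<Rightarrow> 'm \<Rightarrow> complex^'n^'n)
       \<Rightarrow> (('m, 'n) chart \<Rightarrow> 'm \<Rightarrow> complex^'n) \<Rightarrow> (('m, 'n) chart \<Rightarrow> 'm \<Rightarrow> complex^'n)
       \<Rightarrow> 'n \<Rightarrow> ('m, 'n) chart \<Rightarrow> bool"
  where
  "adapted_flat_coordinates A \<eta> e E o1 t \<longleftrightarrow>
     t \<in> A \<and>
     (\<forall>q \<in> fst t. (\<forall>k i j. christoffel \<eta> t k i j q = 0) \<and>
                  e t q = axis o1 1 \<and> diagonal_mat (nabla_matrix \<eta> E t q))"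

definition mu_matrix ::
    "(('m, 'n::finite) chart \<Rightarrow> 'm \<Rightarrow> complex^'n^'n) \<Rightarrow> (('m, 'n) chart \<Rightarrow> 'm \<Rightarrow> complex^'n) \<Rightarrow> complex
       \<Rightarrow> ('m, 'n) chart \<Rightarrow> 'm \<Rightarrow> complex^'n^'n"
  where
  "mu_matrix \<eta> E d x q = mat ((2 - d) / 2) - nabla_matrix \<eta> E x q"

definition U_matrix ::
    "(('m, 'n::finite) chart \<Rightarrow> 'm \<Rightarrow> complex^'n^'n^'n) \<Rightarrow> (('m, 'n) chart \<Rightarrow> 'm \<Rightarrow> complex^'n)
       \<Rightarrow> ('m, 'n) chart \<Rightarrow> 'm \<Rightarrow> complex^'n^'n"
  where
  "U_matrix c E x q = (\<chi> k j. mult (c x q) (E x q) (axis j 1) $ k)"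

section \<open>Extended deformed connection and cyclic stratum\<close>

text \<open>
  A section \<open>Y\<close> of the pullback of the tangent bundle to \<open>\<complex>\<^sup>* \<times> M\<close> has components \<open>Y x z q\<close>
  with respect to the pulled back coordinate frame of \<open>x\<close>. These frames are annihilated by
  the undeformed derivative along \<open>\<partial>/\<partial>z\<close>, which therefore acts componentwise.
\<close>

definition hat_nabla_z ::
    "(('m, 'n::finite) chart \<Rightarrow> 'm \<Rightarrow> complex^'n^'n) \<Rightarrow> (('m, 'n) chart \<Rightarrow> 'm \<Rightarrow> complex^'n^'n^'n)
       \<Rightarrow> (('m, 'n) chart \<Rightarrow> 'm \<Rightarrow> complex^'n) \<Rightarrow> complex
       \<Rightarrow> (('m, 'n) chart \<Rightarrow> complex \<Rightarrow> 'm \<Rightarrow> complex^'n)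
       \<Rightarrow> (('m, 'n) chart \<Rightarrow> complex \<Rightarrow> 'm \<Rightarrow> complex^'n)"
  where
  "hat_nabla_z \<eta> c E d Y = (\<lambda>x z q.
     (\<chi> i. deriv (\<lambda>w. Y x w q $ i) z)
     + U_matrix c E x q *v Y x z q
     - (1 / z) *s (mu_matrix \<eta> E d x q *v Y x z q))"

definition cyclic_vector ::
    "(('m, 'n::finite) chart \<Rightarrow> 'm \<Rightarrow> complex^'n^'n) \<Rightarrow> (('m, 'n) chart \<Rightarrow> 'm \<Rightarrow> complex^'n^'n^'n)
       \<Rightarrow> (('m, 'n) chart \<Rightarrow> 'm \<Rightarrow> complex^'n) \<Rightarrow> (('m, 'n) chart \<Rightarrow> 'm \<Rightarrow> complex^'n) \<Rightarrow> complex
       \<Rightarrow> nat \<Rightarrow> ('m, 'n) chart \<Rightarrow> complex \<Rightarrow> 'm \<Rightarrow> complex^'n"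
  where
  "cyclic_vector \<eta> c e E d k = (hat_nabla_z \<eta> c E d ^^ k) (\<lambda>x z q. e x q)"

definition is_basis :: "(nat \<Rightarrow> complex^'n::finite) \<Rightarrow> bool" where
  "is_basis b \<longleftrightarrow> inj_on b {..<CARD('n)} \<and> vec.independent (b ` {..<CARD('n)}) \<and>
                 vec.span (b ` {..<CARD('n)}) = UNIV"

definition M_hat :: "'m topology \<Rightarrow> (complex \<times> 'm) topology" where
  "M_hat T = prod_topology (top_of_set (- {0})) T"

definition cyclic_stratum ::
    "'m topology \<Rightarrow> ('m, 'n::finite) chart set \<Rightarrow> (('m, 'n) chart \<Rightarrow> 'm \<Rightarrow> complex^'n^'n)
       \<Rightarrow> (('m, 'n) chart \<Rightarrow> 'm \<Rightarrow> complex^'n^'n^'n) \<Rightarrow> (('m, 'n) chart \<Rightarrow> 'm \<Rightarrow> complex^'n)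
       \<Rightarrow> (('m, 'n) chart \<Rightarrow> 'm \<Rightarrow> complex^'n) \<Rightarrow> complex \<Rightarrow> (complex \<times> 'm) set"
  where
  "cyclic_stratum T A \<eta> c e E d =
     \<Union> {W. openin (M_hat T) W \<and>
            (\<forall>(z, q) \<in> W. \<forall>x\<in>A. q \<in> fst x \<longrightarrow> is_basis (\<lambda>k. cyclic_vector \<eta> c e E d k x z q))}"

definition A_Lambda ::
    "'m topology \<Rightarrow> ('m, 'n::finite) chart set \<Rightarrow> (('m, 'n) chart \<Rightarrow> 'm \<Rightarrow> complex^'n^'n)
       \<Rightarrow> (('m, 'n) chart \<Rightarrow> 'm \<Rightarrow> complex^'n^'n^'n) \<Rightarrow> (('m, 'n) chart \<Rightarrow> 'm \<Rightarrow> complex^'n)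
       \<Rightarrow> (('m, 'n) chart \<Rightarrow> 'm \<Rightarrow> complex^'n) \<Rightarrow> complex \<Rightarrow> 'm set"
  where
  "A_Lambda T A \<eta> c e E d =
     {p \<in> topspace T. (- {0}) \<times> {p} \<subseteq> topspace (M_hat T) - cyclic_stratum T A \<eta> c e E d}"

section \<open>Solutions on the universal cover of the punctured plane\<close>

text \<open>
  The universal cover of \<open>\<complex>\<^sup>*\<close> is realised as \<open>exp : \<complex> \<rightarrow> \<complex>\<^sup>*\<close>. A function on the cover is
  thus a function of \<open>w\<close> (a value of \<open>log z\<close>), with \<open>z = exp w\<close>, \<open>z\<^sup>a = exp (a * w)\<close> and
  \<open>\<partial>/\<partial>z = exp (- w) \<partial>/\<partial>w\<close>.
\<close>

definition holomorphic_on_cover :: "(complex \<Rightarrow> complex) set" where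
  "holomorphic_on_cover = {f. f holomorphic_on UNIV}"

definition cover_deriv :: "(complex \<Rightarrow> complex) \<Rightarrow> complex \<Rightarrow> complex" where
  "cover_deriv f w = deriv f w / exp w"

definition cover_powr :: "complex \<Rightarrow> complex \<Rightarrow> complex" where
  "cover_powr a w = exp (a * w)"

text \<open>The solutions of \<open>\<partial>\<xi>/\<partial>z = (U\<^sup>T - \<mu>/z) \<xi>\<close>.\<close>

definition solution_space :: "complex^'n^'n \<Rightarrow> complex^'n^'n \<Rightarrow> (complex \<Rightarrow> complex^'n::finite) set" where
  "solution_space U \<mu> =
     {\<xi>. (\<forall>i. (\<lambda>w. \<xi> w $ i) \<in> holomorphic_on_cover) \<and>
         (\<forall>w. (\<chi> i. cover_deriv (\<lambda>u. \<xi> u $ i) w)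
               = (transpose U - map_matrix (\<lambda>a. (1 / exp w) * a) \<mu>) *v \<xi> w)}"

text \<open>The map \<open>\<nu>\<^sub>p\<close>; \<open>v\<close> stands for the components of \<open>e(p)\<close>.\<close>

definition nu_map :: "complex \<Rightarrow> complex^'n::finite \<Rightarrow> (complex \<Rightarrow> complex^'n) \<Rightarrow> complex \<Rightarrow> complex" where
  "nu_map d v \<xi> = (\<lambda>w. cover_powr (- d / 2) w * (\<Sum>i\<in>UNIV. \<xi> w $ i * v $ i))"

text \<open>
  \<open>S\<close> is a \<open>\<complex>\<close>-subspace (for the pointwise operations) and \<open>F\<close> is \<open>\<complex>\<close>-linear on it.
\<close>

definition linear_on_subspace ::
    "(complex \<Rightarrow> complex^'n::finite) set \<Rightarrow> ((complex \<Rightarrow> complex^'n) \<Rightarrow> complex \<Rightarrow> complex) \<Rightarrow> bool"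
  where
  "linear_on_subspace S F \<longleftrightarrow>
     (\<lambda>w. 0) \<in> S \<and>
     (\<forall>f\<in>S. \<forall>g\<in>S. (\<lambda>w. f w + g w) \<in> S \<and> F (\<lambda>w. f w + g w) = (\<lambda>w. F f w + F g w)) \<and>
     (\<forall>a. \<forall>f\<in>S. (\<lambda>w. a *s f w) \<in> S \<and> F (\<lambda>w. a *s f w) = (\<lambda>w. a * F f w))"

end

theory Submission
  imports Defs "HOL-Complex_Analysis.Conformal_Mappings"
begin

text \<open>
  The equation \<open>\<partial>\<xi>/\<partial>z = (\<U>\<^sup>T - \<mu>/z) \<xi>\<close> says that \<open>\<xi>\<close> is flat in the \<open>z\<close>-direction for the
  dual of the extended deformed connection. Writing \<open>\<nabla>\<^sub>z\<close> for the derivative of that connection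
  along \<open>\<partial>/\<partial>z\<close>, this means \<open>\<partial>/\<partial>z \<langle>\<xi>, Y\<rangle> = \<langle>\<xi>, \<nabla>\<^sub>z Y\<rangle>\<close> for every
  section \<open>Y\<close>. This uses that \<open>\<mu>\<close> is a symmetric matrix, which holds because
  \<open>\<nabla>E\<close> is diagonal in the adapted coordinates. Consequently the \<open>k\<close>-th \<open>z\<close>-derivative of
  \<open>\<langle>\<xi>, e\<rangle>\<close> is \<open>\<langle>\<xi>, e\<^sub>k\<rangle>\<close>. If \<open>\<Phi>\<^sub>\<xi> = 0\<close>, then \<open>\<langle>\<xi>, e\<rangle>\<close> vanishes, because \<open>z\<close> to the power
  \<open>-d/2\<close> has no zeros, and therefore \<open>\<xi>\<close> annihilates all the \<open>e\<^sub>k\<close> at all points of the cover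
  (\<open>solution_annihilates_iterates\<close>).

  Since \<open>p\<close> is not in the \<open>\<A>\<^sub>\<Lambda>\<close>-stratum, some \<open>(z\<^sub>0, p)\<close> lies in the cyclic stratum.
  That stratum is open, so the \<open>e\<^sub>k\<close> form a basis at \<open>(z, p)\<close> for all \<open>z\<close> near \<open>z\<^sub>0\<close>
  (\<open>cyclic_near_some_point\<close>). Hence \<open>\<xi>\<close> vanishes on a nonempty open subset of the cover, and the
  identity theorem gives \<open>\<xi> = 0\<close>.
\<close>

unbundle no fps_syntax

section \<open>The deformed connection over a point\<close>

text \<open>
  The derivative \<open>\<nabla>\<^sub>z\<close> of the deformed connection, restricted to the punctured plane over one
  point of the manifold. It involves no derivatives along the manifold, so its
  iterates are computed in a fixed tangent space.
\<close>

definition fibre_nabla_z ::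
    "complex^'n^'n \<Rightarrow> complex^'n^'n \<Rightarrow> (complex \<Rightarrow> complex^'n) \<Rightarrow> complex \<Rightarrow> complex^'n::finite" where
  "fibre_nabla_z U \<mu> Y =
     (\<lambda>z. (\<chi> i. deriv (\<lambda>w. Y w $ i) z) + U *v Y z - (1 / z) *s (\<mu> *v Y z))"

lemma cyclic_vector_eq_fibre:
  "cyclic_vector \<eta> c e E d k x z q
     = (fibre_nabla_z (U_matrix c E x q) (mu_matrix \<eta> E d x q) ^^ k) (\<lambda>_. e x q) z"
proof -
  have "(\<lambda>z. cyclic_vector \<eta> c e E d k x z q)
     = (fibre_nabla_z (U_matrix c E x q) (mu_matrix \<eta> E d x q) ^^ k) (\<lambda>_. e x q)"
    by (induction k) (auto simp: cyclic_vector_def hat_nabla_z_def fibre_nabla_z_def fun_eq_iff)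
  then show ?thesis by (simp add: fun_eq_iff)
qed

lemma fibre_nabla_z_holomorphic:
  assumes "\<And>i. (\<lambda>z. Y z $ i) holomorphic_on - {0}"
  shows "(\<lambda>z. fibre_nabla_z U \<mu> Y z $ i) holomorphic_on - {0}"
  unfolding fibre_nabla_z_def
  by (auto simp: matrix_vector_mult_def intro!: holomorphic_intros assms)

lemma funpow_fibre_nabla_z_holomorphic:
  "(\<lambda>z. (fibre_nabla_z U \<mu> ^^ k) (\<lambda>_. v) z $ i) holomorphic_on - {0}"
  by (induction k arbitrary: i) (auto intro!: fibre_nabla_z_holomorphic)

section \<open>Duality between solutions and sections\<close>

lemma solution_space_DERIV:
  assumes "\<xi> \<in> solution_space U \<mu>"
  shows "((\<lambda>w. \<xi> w $ i) has_field_derivative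
           exp w * ((transpose U - map_matrix (\<lambda>a. (1 / exp w) * a) \<mu>) *v \<xi> w) $ i) (at w)"
proof -
  have hol: "(\<lambda>w. \<xi> w $ i) holomorphic_on UNIV"
    using assms by (auto simp: solution_space_def holomorphic_on_cover_def)
  have "(\<chi> i. cover_deriv (\<lambda>u. \<xi> u $ i) w)
          = (transpose U - map_matrix (\<lambda>a. (1 / exp w) * a) \<mu>) *v \<xi> w"
    using assms by (auto simp: solution_space_def)
  then have "cover_deriv (\<lambda>u. \<xi> u $ i) w
          = ((transpose U - map_matrix (\<lambda>a. (1 / exp w) * a) \<mu>) *v \<xi> w) $ i"
    by (metis vec_lambda_beta)
  then have "deriv (\<lambda>u. \<xi> u $ i) w
          = exp w * ((transpose U - map_matrix (\<lambda>a. (1 / exp w) * a) \<mu>) *v \<xi> w) $ i"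
    by (simp add: cover_deriv_def field_simps)
  then show ?thesis
    using holomorphic_derivI[OF hol open_UNIV UNIV_I] by metis
qed

text \<open>
  The coefficient matrix of the differential equation is the transpose of \<open>\<U> - \<mu>/z\<close> when \<open>\<mu>\<close> is
  symmetric. Moving it to the other side of the pairing produces exactly the algebraic part of
  \<open>\<nabla>\<^sub>z\<close>.
\<close>

lemma pairing_transpose:
  fixes U \<mu> :: "complex^'n::finite^'n"
  assumes "transpose \<mu> = \<mu>"
  shows "(\<Sum>i\<in>UNIV. ((transpose U - map_matrix (\<lambda>a. (1 / z) * a) \<mu>) *v \<xi>) $ i * v $ i)
       = (\<Sum>i\<in>UNIV. \<xi> $ i * (U *v v - (1 / z) *s (\<mu> *v v)) $ i)"
proof -
  have sym: "\<mu> $ i $ j = \<mu> $ j $ i" for i j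
    using assms by (metis transpose_def vec_lambda_beta)
  have "(\<Sum>i\<in>UNIV. ((transpose U - map_matrix (\<lambda>a. (1 / z) * a) \<mu>) *v \<xi>) $ i * v $ i)
      = (\<Sum>i\<in>UNIV. \<Sum>j\<in>UNIV. (U $ j $ i - (1 / z) * \<mu> $ j $ i) * \<xi> $ j * v $ i)"
    by (simp add: matrix_vector_mult_def transpose_def map_matrix_def sum_distrib_right sym)
  also have "\<dots> = (\<Sum>j\<in>UNIV. \<Sum>i\<in>UNIV. (U $ j $ i - (1 / z) * \<mu> $ j $ i) * \<xi> $ j * v $ i)"
    by (rule sum.swap)
  also have "\<dots> = (\<Sum>i\<in>UNIV. \<xi> $ i * (U *v v - (1 / z) *s (\<mu> *v v)) $ i)"
    by (simp add: matrix_vector_mult_def sum_distrib_left sum_subtractf algebra_simps)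
  finally show ?thesis .
qed

text \<open>
  The duality \<open>\<partial>/\<partial>z \<langle>\<xi>, Y\<rangle> = \<langle>\<xi>, \<nabla>\<^sub>z Y\<rangle>\<close>, written in the coordinate \<open>w\<close> with \<open>z = exp w\<close>, where
  \<open>\<partial>/\<partial>w = z \<partial>/\<partial>z\<close>.
\<close>

lemma DERIV_pairing_solution:
  fixes \<xi> :: "complex \<Rightarrow> complex^'n::finite"
  assumes \<xi>: "\<xi> \<in> solution_space U \<mu>" and sym: "transpose \<mu> = \<mu>"
    and Y: "\<And>i. (\<lambda>z. Y z $ i) holomorphic_on - {0}"
  shows "((\<lambda>w. \<Sum>i\<in>UNIV. \<xi> w $ i * Y (exp w) $ i) has_field_derivative
           exp w * (\<Sum>i\<in>UNIV. \<xi> w $ i * fibre_nabla_z U \<mu> Y (exp w) $ i)) (at w)"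
proof -
  let ?B = "(transpose U - map_matrix (\<lambda>a. (1 / exp w) * a) \<mu>) *v \<xi> w"
  let ?Y' = "\<lambda>i. deriv (\<lambda>z. Y z $ i) (exp w)"
  have DY: "((\<lambda>w. Y (exp w) $ i) has_field_derivative ?Y' i * exp w) (at w)" for i
  proof -
    have "((\<lambda>z. Y z $ i) has_field_derivative ?Y' i) (at (exp w))"
      by (rule holomorphic_derivI[OF Y]) auto
    then show ?thesis by (rule DERIV_chain2) (rule DERIV_exp)
  qed
  have "((\<lambda>w. \<Sum>i\<in>UNIV. \<xi> w $ i * Y (exp w) $ i) has_field_derivative
          (\<Sum>i\<in>UNIV. exp w * ?B $ i * Y (exp w) $ i + ?Y' i * exp w * \<xi> w $ i)) (at w)"
    by (intro DERIV_sum DERIV_mult solution_space_DERIV[OF \<xi>] DY)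
  also have "(\<Sum>i\<in>UNIV. exp w * ?B $ i * Y (exp w) $ i + ?Y' i * exp w * \<xi> w $ i)
      = exp w * ((\<Sum>i\<in>UNIV. ?B $ i * Y (exp w) $ i) + (\<Sum>i\<in>UNIV. \<xi> w $ i * ?Y' i))"
    unfolding sum.distrib[symmetric] sum_distrib_left
    by (rule sum.cong) (algebra | rule refl)+
  also have "\<dots> = exp w * (\<Sum>i\<in>UNIV. \<xi> w $ i * fibre_nabla_z U \<mu> Y (exp w) $ i)"
    unfolding pairing_transpose[OF sym]
    by (simp add: fibre_nabla_z_def sum.distrib[symmetric] algebra_simps)
  finally show ?thesis .
qed

lemma solution_annihilates_iterates:
  fixes \<xi> :: "complex \<Rightarrow> complex^'n::finite"
  assumes \<xi>: "\<xi> \<in> solution_space U \<mu>" and sym: "transpose \<mu> = \<mu>"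
    and zero: "\<And>w. (\<Sum>i\<in>UNIV. \<xi> w $ i * v $ i) = 0"
  shows "(\<Sum>i\<in>UNIV. \<xi> w $ i * (fibre_nabla_z U \<mu> ^^ k) (\<lambda>_. v) (exp w) $ i) = 0"
proof (induction k arbitrary: w)
  case 0
  then show ?case by (simp add: zero)
next
  case (Suc k)
  let ?Y = "(fibre_nabla_z U \<mu> ^^ k) (\<lambda>_. v)"
  have "((\<lambda>w. \<Sum>i\<in>UNIV. \<xi> w $ i * ?Y (exp w) $ i) has_field_derivative
           exp w * (\<Sum>i\<in>UNIV. \<xi> w $ i * fibre_nabla_z U \<mu> ?Y (exp w) $ i)) (at w)"
    by (rule DERIV_pairing_solution[OF \<xi> sym funpow_fibre_nabla_z_holomorphic])
  moreover have "((\<lambda>w. \<Sum>i\<in>UNIV. \<xi> w $ i * ?Y (exp w) $ i) has_field_derivative 0) (at w)"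
    unfolding Suc.IH by (rule DERIV_const)
  ultimately have "exp w * (\<Sum>i\<in>UNIV. \<xi> w $ i * fibre_nabla_z U \<mu> ?Y (exp w) $ i) = 0"
    by (rule DERIV_unique)
  then show ?case by simp
qed

section \<open>Cyclicity near a point outside the stratum\<close>

lemma annihilates_basis_imp_zero:
  fixes u :: "complex^'n::finite"
  assumes "is_basis b" and zero: "\<And>k. (\<Sum>i\<in>UNIV. u $ i * b k $ i) = 0"
  shows "u = 0"
proof -
  let ?K = "{v :: complex^'n. (\<Sum>i\<in>UNIV. u $ i * v $ i) = 0}"
  have "vec.subspace ?K"
    by (auto simp: vec.subspace_def algebra_simps sum.distrib sum_distrib_left[symmetric])
  then have "vec.span (b ` {..<CARD('n)}) \<subseteq> ?K"
    by (intro vec.span_minimal) (auto simp: zero)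
  then have "axis j 1 \<in> ?K" for j
    using assms(1) by (auto simp: is_basis_def)
  then show ?thesis
    by (simp add: vec_eq_iff axis_def if_distrib cong: if_cong)
qed

text \<open>
  The product topology turns an open neighbourhood of \<open>(z\<^sub>0, p)\<close> in the cyclic stratum into an open
  set of values of \<open>z\<close> over the single point \<open>p\<close>; its openness is what makes analytic
  continuation applicable.
\<close>

lemma (in frobenius_manifold) cyclic_near_some_point:
  assumes p: "p \<in> topspace T - A_Lambda T A \<eta> c e E d" and x: "x \<in> A" "p \<in> fst x"
  obtains S where "open S" "S \<subseteq> - {0}" "S \<noteq> {}"
    "\<And>z. z \<in> S \<Longrightarrow> is_basis (\<lambda>k. cyclic_vector \<eta> c e E d k x z p)"
proof -
  obtain z0 where z0: "z0 \<noteq> 0" "(z0, p) \<in> cyclic_stratum T A \<eta> c e E d"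
    using p by (auto simp: A_Lambda_def M_hat_def)
  then obtain W where W: "openin (M_hat T) W" "(z0, p) \<in> W"
    and basis: "\<And>z q x. (z, q) \<in> W \<Longrightarrow> x \<in> A \<Longrightarrow> q \<in> fst x \<Longrightarrow>
                  is_basis (\<lambda>k. cyclic_vector \<eta> c e E d k x z q)"
    unfolding cyclic_stratum_def by blast
  obtain S V where S: "openin (top_of_set (- {0})) S" and V: "z0 \<in> S" "p \<in> V" "S \<times> V \<subseteq> W"
    using W unfolding M_hat_def openin_prod_topology_alt by metis
  have "open S"
    using S by (simp add: openin_open_eq open_Compl)
  moreover have "S \<subseteq> - {0}"
    using openin_subset[OF S] by simp
  ultimately show ?thesis
    using that[of S] V basis x by blast
qed

section \<open>Linearity and injectivity\<close>

lemma solution_space_add: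
  assumes "f \<in> solution_space U \<mu>" "g \<in> solution_space U \<mu>"
  shows "(\<lambda>w. f w + g w) \<in> solution_space U \<mu>"
proof -
  have "((\<lambda>w. (f w + g w) $ i) has_field_derivative
          exp w * ((transpose U - map_matrix (\<lambda>a. (1 / exp w) * a) \<mu>) *v (f w + g w)) $ i) (at w)"
    for i w
    using DERIV_add[OF solution_space_DERIV[OF assms(1), of i w] solution_space_DERIV[OF assms(2), of i w]]
    by (simp add: matrix_vector_right_distrib algebra_simps)
  from DERIV_imp_deriv[OF this] assms show ?thesis
    by (auto simp: solution_space_def cover_deriv_def holomorphic_on_cover_def vec_eq_iff
             intro!: holomorphic_intros)
qed

lemma solution_space_scale:
  assumes "f \<in> solution_space U \<mu>"
  shows "(\<lambda>w. a *s f w) \<in> solution_space U \<mu>"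
proof -
  have "((\<lambda>w. (a *s f w) $ i) has_field_derivative
          exp w * ((transpose U - map_matrix (\<lambda>a. (1 / exp w) * a) \<mu>) *v (a *s f w)) $ i) (at w)"
    for i w
    using DERIV_cmult[OF solution_space_DERIV[OF assms, of i w], of a]
    by (simp add: vec.scale algebra_simps)
  from DERIV_imp_deriv[OF this] assms show ?thesis
    by (auto simp: solution_space_def cover_deriv_def holomorphic_on_cover_def vec_eq_iff
             intro!: holomorphic_intros)
qed

lemma linear_on_solution_space_nu_map: "linear_on_subspace (solution_space U \<mu>) (nu_map d v)"
proof -
  have "(\<lambda>w. 0) \<in> solution_space U \<mu>"
    by (simp add: solution_space_def cover_deriv_def holomorphic_on_cover_def vec_eq_iff)
  then show ?thesis
    by (auto simp: linear_on_subspace_def solution_space_add solution_space_scale nu_map_def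
          fun_eq_iff sum.distrib sum_distrib_left algebra_simps)
qed

lemma nu_map_holomorphic:
  "\<xi> \<in> solution_space U \<mu> \<Longrightarrow> nu_map d v \<xi> \<in> holomorphic_on_cover"
  by (auto simp: solution_space_def holomorphic_on_cover_def nu_map_def cover_powr_def
           intro!: holomorphic_intros)

text \<open>
  Cyclicity of \<open>v\<close> on an open set of values of \<open>z\<close>, however small, suffices: a solution vanishing
  there vanishes on the whole cover by analytic continuation.
\<close>

lemma nu_map_kernel_trivial:
  fixes \<xi> :: "complex \<Rightarrow> complex^'n::finite"
  assumes \<xi>: "\<xi> \<in> solution_space U \<mu>" and sym: "transpose \<mu> = \<mu>"
    and S: "open S" "S \<subseteq> - {0}" "S \<noteq> {}"
    and basis: "\<And>z. z \<in> S \<Longrightarrow> is_basis (\<lambda>k. (fibre_nabla_z U \<mu> ^^ k) (\<lambda>_. v) z)"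
    and ker: "nu_map d v \<xi> = (\<lambda>w. 0)"
  shows "\<xi> = (\<lambda>w. 0)"
proof -
  have "(\<Sum>i\<in>UNIV. \<xi> w $ i * v $ i) = 0" for w
    using fun_cong[OF ker, of w] by (simp add: nu_map_def cover_powr_def)
  note ann = solution_annihilates_iterates[OF \<xi> sym this]
  have vanish: "\<xi> w = 0" if "exp w \<in> S" for w
    using annihilates_basis_imp_zero[OF basis[OF that] ann] .
  have "open (exp -` S)"
    using S(1) by (intro open_vimage continuous_intros)
  moreover have "exp -` S \<noteq> {}"
  proof -
    obtain z where "z \<in> S" "z \<noteq> 0" using S by blast
    then have "Ln z \<in> exp -` S" by simp
    then show ?thesis by blast
  qed
  moreover have "(\<lambda>w. \<xi> w $ i) holomorphic_on UNIV" for i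
    using \<xi> by (auto simp: solution_space_def holomorphic_on_cover_def)
  ultimately have "\<xi> w $ i = 0" for w i
    using analytic_continuation_open[of "exp -` S" UNIV "\<lambda>w. \<xi> w $ i" "\<lambda>_. 0" w] vanish by auto
  then show ?thesis by (simp add: fun_eq_iff vec_eq_iff)
qed

lemma linear_on_subspace_inj_on:
  assumes lin: "linear_on_subspace S F"
    and ker: "\<And>f. f \<in> S \<Longrightarrow> F f = (\<lambda>w. 0) \<Longrightarrow> f = (\<lambda>w. 0)"
  shows "inj_on F S"
proof (rule inj_onI)
  fix f g assume fg: "f \<in> S" "g \<in> S" "F f = F g"
  let ?g = "\<lambda>w. (- 1) *s g w"
  have g: "?g \<in> S" "F ?g = (\<lambda>w. - 1 * F g w)"
    using lin fg unfolding linear_on_subspace_def by blast+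
  have add: "(\<lambda>w. f w + h w) \<in> S \<and> F (\<lambda>w. f w + h w) = (\<lambda>w. F f w + F h w)" if "h \<in> S" for h
    using lin fg(1) that unfolding linear_on_subspace_def by blast
  have "(\<lambda>w. f w + ?g w) = (\<lambda>w. 0)"
    using add[OF g(1)] fg g by (intro ker) auto
  then show "f = g" by (simp add: fun_eq_iff vec_eq_iff)
qed

theorem theorem2p31:
  fixes T :: "'m topology" and A :: "('m, 'n::finite) chart set"
    and \<eta> :: "('m, 'n) chart \<Rightarrow> 'm \<Rightarrow> complex^'n^'n"
    and c :: "('m, 'n) chart \<Rightarrow> 'm \<Rightarrow> complex^'n^'n^'n"
    and e E :: "('m, 'n) chart \<Rightarrow> 'm \<Rightarrow> complex^'n"
    and d :: complex and t :: "('m, 'n) chart" and o1 :: 'n and p :: 'm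
  assumes "frobenius_manifold T A \<eta> c e E d"
    and "nabla_Euler_diagonalizable A \<eta> E"
    and "generically_semisimple T A c"
    and "p \<in> topspace T - A_Lambda T A \<eta> c e E d"
    and "adapted_flat_coordinates A \<eta> e E o1 t" and "p \<in> fst t"
  defines "X \<equiv> solution_space (U_matrix c E t p) (mu_matrix \<eta> E d t p)"
    and "\<nu> \<equiv> nu_map d (e t p)"
  shows "linear_on_subspace X \<nu> \<and> \<nu> ` X \<subseteq> holomorphic_on_cover \<and> inj_on \<nu> X"
proof -
  let ?U = "U_matrix c E t p" and ?\<mu> = "mu_matrix \<eta> E d t p"
  have t: "t \<in> A" and diag: "diagonal_mat (nabla_matrix \<eta> E t p)"
    using assms(5,6) by (auto simp: adapted_flat_coordinates_def)
  have "?\<mu> $ j $ i = ?\<mu> $ i $ j" for i j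
    using diag by (cases "i = j") (auto simp: mu_matrix_def diagonal_mat_def mat_def)
  then have sym: "transpose ?\<mu> = ?\<mu>"
    by (simp add: transpose_def vec_eq_iff)
  obtain S where S: "open S" "S \<subseteq> - {0}" "S \<noteq> {}"
    and basis: "\<And>z. z \<in> S \<Longrightarrow> is_basis (\<lambda>k. (fibre_nabla_z ?U ?\<mu> ^^ k) (\<lambda>_. e t p) z)"
    using frobenius_manifold.cyclic_near_some_point[OF assms(1,4) t assms(6)]
    unfolding cyclic_vector_eq_fibre by metis
  have lin: "linear_on_subspace X \<nu>"
    unfolding X_def \<nu>_def by (rule linear_on_solution_space_nu_map)
  moreover have "\<nu> ` X \<subseteq> holomorphic_on_cover"
    unfolding X_def \<nu>_def using nu_map_holomorphic by blast
  moreover have "inj_on \<nu> X"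
  proof (rule linear_on_subspace_inj_on[OF lin])
    fix \<xi> assume "\<xi> \<in> X" "\<nu> \<xi> = (\<lambda>w. 0)"
    then show "\<xi> = (\<lambda>w. 0)"
      unfolding X_def \<nu>_def by (intro nu_map_kernel_trivial[OF _ sym S basis])
  qed
  ultimately show ?thesis by blast
qed

end
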